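(* Let $T$ be a rooted tree. The coheight profile $\mathbf{x}_h$ of $T$ can be reconstructed from the sampling function $F_T$; that is, if $T,T'$ are rooted trees with $F_T=F_{T'}$, then $T$ and $T'$ have the same coheight profile.
   Context: $T$ is a finite rooted tree with root $v_T$; $h_v$ is the coheight of $v$ (length of the path from $v_T$ to $v$). The coheight profile is $\mathbf{x}_h=\prod_{v\in V(T)}x_{h_v}$ (a monomial in indeterminates $x_0,x_1,\dots$). A coloring $f\colon V(T)\to\mathbb{Z}^+$ is increasing if $f(u)<f(v)$ whenever $u$ is the parent of $v$; $\mathbf{x}_f=\prod_v x_{f(v)}$; $\Gamma^<(T;\mathbf{x})=\sum_{f\text{ increasing}}\mathbf{x}_f$. Monomials are ordered lexicographically by exponent tuples (larger exponent at the first differing index means larger). For $n\in\mathbb{N}$, $\left[\prod_{i\le n}x_i^{e_i}\right]p$ is the sum of the terms of $p$ whose exponent of $x_i$ equals $e_i$ for all $i\le n$. The sampling function is $F_T\left(\prod_{i\le n}x_i^{e_i}\right)=\max\left(\left[\prod_{i\le n}x_i^{e_i}\right]\Gamma^<(T;\mathbf{x})\right)$ (the greatest such monomial, coefficient discarded, or $\varnothing$ if none), where inputs are monomials in $x_1,x_2,\dots$ together with $n$. *)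

theory Defs
  imports "Graph_Theory.Graph_Theory" "HOL-Library.Poly_Mapping" "HOL-Library.FuncSet"
begin

text \<open>
  A rooted tree is given by its arcs from parent to child. Uniqueness of the walk from the root
  to each vertex rules out loops, parallel arcs, arcs into the root and vertices with two parents.
  (The predicate \<open>tree\<close> of the imported graph library only forbids directed cycles, so it
  would admit digraphs whose underlying graph is not a tree.)
\<close>

locale finite_rooted_tree = fin_digraph T for T :: "('a, 'b) pre_digraph" +
  fixes r :: 'a
  assumes root_in_verts: "r \<in> verts T"
    and unique_awalk: "v \<in> verts T \<Longrightarrow> \<exists>!p. awalk r p v"

definition coheight :: "('a, 'b) pre_digraph \<Rightarrow> 'a \<Rightarrow> 'a \<Rightarrow> nat" where
  "coheight T r v = length (THE p. pre_digraph.awalk T r p v)"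

text \<open>
  A monomial in \<open>x\<^sub>0, x\<^sub>1, \<dots>\<close> is its exponent sequence, so that products of monomials are sums.
  The library order on \<^typ>\<open>nat \<Rightarrow>\<^sub>0 nat\<close> compares at the first differing index,
  i.e. it is the lexicographic order on exponent sequences.
  A formal power series in infinitely many indeterminates is its coefficient function.
\<close>

type_synonym monomial = "nat \<Rightarrow>\<^sub>0 nat"

type_synonym power_series = "monomial \<Rightarrow> int"

definition labelling_monomial :: "('a, 'b) pre_digraph \<Rightarrow> ('a \<Rightarrow> nat) \<Rightarrow> monomial" where
  "labelling_monomial T f = (\<Sum>v\<in>verts T. Poly_Mapping.single (f v) 1)"

definition coheight_profile :: "('a, 'b) pre_digraph \<Rightarrow> 'a \<Rightarrow> monomial" where
  "coheight_profile T r = labelling_monomial T (coheight T r)"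

definition increasing_colorings :: "('a, 'b) pre_digraph \<Rightarrow> ('a \<Rightarrow> nat) set" where
  "increasing_colorings T =
     {f \<in> verts T \<rightarrow>\<^sub>E {1..}. \<forall>u v. u \<rightarrow>\<^bsub>T\<^esub> v \<longrightarrow> f u < f v}"

text \<open>
  The coefficient of \<open>m\<close> in \<open>\<Sum>f. x\<^sub>f\<close> is the number of \<open>f\<close> with \<open>x\<^sub>f = m\<close>; see
  \<open>finite_colorings_of_monomial\<close> for its finiteness.
\<close>

definition Gamma_less :: "('a, 'b) pre_digraph \<Rightarrow> power_series" where
  "Gamma_less T m = int (card {f \<in> increasing_colorings T. labelling_monomial T f = m})"

lemma finite_colorings_of_monomial:
  assumes "finite (verts T)"
  shows "finite {f \<in> increasing_colorings T. labelling_monomial T f = m}"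
proof (rule finite_subset)
  show "finite (verts T \<rightarrow>\<^sub>E Poly_Mapping.keys m)"
    using assms by (intro finite_PiE) auto
  show "{f \<in> increasing_colorings T. labelling_monomial T f = m}
          \<subseteq> verts T \<rightarrow>\<^sub>E Poly_Mapping.keys m"
  proof
    fix f assume f: "f \<in> {f \<in> increasing_colorings T. labelling_monomial T f = m}"
    have "f v \<in> Poly_Mapping.keys m" if v: "v \<in> verts T" for v
    proof -
      have "Poly_Mapping.lookup m (f v) =
              (\<Sum>w\<in>verts T. Poly_Mapping.lookup (Poly_Mapping.single (f w) 1) (f v))"
        using f by (auto simp: labelling_monomial_def lookup_sum)
      also have "\<dots> \<ge> Poly_Mapping.lookup (Poly_Mapping.single (f v) (1::nat)) (f v)"
        using assms v
        by (intro member_le_sum[where f = "\<lambda>w. Poly_Mapping.lookup (Poly_Mapping.single (f w) 1) (f v)"]) auto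
      finally show ?thesis by (simp add: in_keys_iff)
    qed
    with f show "f \<in> verts T \<rightarrow>\<^sub>E Poly_Mapping.keys m"
      by (auto simp: increasing_colorings_def PiE_def)
  qed
qed

text \<open>
  The bracket \<open>[\<Prod>i\<le>n. x\<^sub>i\<^bsup>e\<^sub>i\<^esup>] p\<close>, where the indices \<open>i\<close> start at \<open>1\<close>.
\<close>

definition restrict_terms :: "nat \<Rightarrow> monomial \<Rightarrow> power_series \<Rightarrow> power_series" where
  "restrict_terms n e p =
     (\<lambda>m. if \<forall>i\<in>{1..n}. Poly_Mapping.lookup m i = Poly_Mapping.lookup e i then p m else 0)"

text \<open>
  \<^const>\<open>None\<close> stands for \<open>\<emptyset>\<close>. For a nonzero series whose terms have bounded
  degree, such as any \<open>restrict_terms n e (Gamma_less T)\<close>, the maximum always exists.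
\<close>

definition max_monomial :: "power_series \<Rightarrow> monomial option" where
  "max_monomial p =
     (if \<exists>m. p m \<noteq> 0 \<and> (\<forall>m'. p m' \<noteq> 0 \<longrightarrow> m' \<le> m)
      then Some (GREATEST m. p m \<noteq> 0) else None)"

text \<open>
  The arguments are pairs of \<open>n\<close> and a monomial in \<open>x\<^sub>1, \<dots>, x\<^sub>n\<close>; the pair is needed because
  the exponents \<open>e\<^sub>i\<close> may vanish. Outside this domain the value is the fixed
  \<^const>\<open>undefined\<close>, so equality of sampling functions is equality on the domain.
\<close>

definition sampling_function ::
    "('a, 'b) pre_digraph \<Rightarrow> nat \<times> monomial \<Rightarrow> monomial option" where
  "sampling_function T =
     (\<lambda>(n, e)\<in>{(n, e). Poly_Mapping.keys e \<subseteq> {1..n}}.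
        max_monomial (restrict_terms n e (Gamma_less T)))"

end

theory Submission
  imports Defs
begin

text \<open>
  Along an increasing coloring the colors strictly grow from the root, so every vertex \<open>v\<close> gets
  a color at least \<open>h\<^sub>v + 1\<close>, and \<open>v \<mapsto> h\<^sub>v + 1\<close> is itself increasing. Since pointwise smaller
  colors give a lexicographically larger monomial, \<open>F\<^sub>T(1)\<close> (with \<open>n = 0\<close>) is the coheight
  profile with all indices shifted by one.
\<close>

lemma lookup_labelling_monomial:
  assumes "finite (verts T)"
  shows "Poly_Mapping.lookup (labelling_monomial T f) k = card {v \<in> verts T. f v = k}"
proof -
  have "Poly_Mapping.lookup (labelling_monomial T f) k = (\<Sum>v\<in>verts T. if f v = k then 1 else 0)"
    by (auto simp: labelling_monomial_def lookup_sum lookup_single when_def intro: sum.cong)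
  also have "\<dots> = card {v \<in> verts T. f v = k}"
    using assms by (simp flip: sum.inter_filter)
  finally show ?thesis .
qed

text \<open>If the order were reversed, then at the first differing index \<open>k\<close> strictly
  fewer vertices would have \<open>g\<close>-color at most \<open>k\<close> than
  \<open>f\<close>-color at most \<open>k\<close>. But lowering colors can only add vertices to the
  set of those colored at most \<open>k\<close>.\<close>

lemma labelling_monomial_antimono:
  assumes fin: "finite (verts T)" and le: "\<And>v. v \<in> verts T \<Longrightarrow> g v \<le> f v"
  shows "labelling_monomial T f \<le> labelling_monomial T g"
proof (rule ccontr)
  assume "\<not> ?thesis"
  then have "labelling_monomial T g < labelling_monomial T f" by simp
  then obtain k where
    less: "card {v \<in> verts T. g v = k} < card {v \<in> verts T. f v = k}"
    and eq: "\<And>i. i < k \<Longrightarrow> card {v \<in> verts T. g v = i} = card {v \<in> verts T. f v = i}"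
    by (auto simp: less_poly_mapping.rep_eq less_fun_def lookup_labelling_monomial[OF fin])
  have cumulative: "card {v \<in> verts T. h v \<le> k} = (\<Sum>i\<le>k. card {v \<in> verts T. h v = i})"
    for h :: "'a \<Rightarrow> nat"
  proof -
    have "{v \<in> verts T. h v \<le> k} = (\<Union>i\<le>k. {v \<in> verts T. h v = i})" by auto
    then show ?thesis using fin by (simp only:) (intro card_UN_disjoint, auto)
  qed
  have "(\<Sum>i\<le>k. card {v \<in> verts T. g v = i}) < (\<Sum>i\<le>k. card {v \<in> verts T. f v = i})"
    using less eq by (intro sum_strict_mono_ex1) (auto simp: le_less)
  moreover have "card {v \<in> verts T. f v \<le> k} \<le> card {v \<in> verts T. g v \<le> k}"
    using fin le by (intro card_mono) (auto intro: order_trans)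
  ultimately show False by (simp add: cumulative)
qed

context finite_rooted_tree
begin

lemma coheight_eq_length:
  assumes "awalk r p v"
  shows "coheight T r v = length p"
proof -
  have "(THE p. awalk r p v) = p"
    using assms unique_awalk[of v] by (intro the1_equality) auto
  then show ?thesis by (simp add: coheight_def)
qed

lemma coheight_arc:
  assumes "u \<rightarrow>\<^bsub>T\<^esub> v"
  shows "coheight T r v = Suc (coheight T r u)"
proof -
  from assms obtain e where e: "e \<in> arcs T" "tail T e = u" "head T e = v" by auto
  then obtain p where p: "awalk r p u" using unique_awalk[of u] by auto
  have "awalk r (p @ [e]) v"
    using p e by (auto simp: awalk_simps)
  from coheight_eq_length[OF this] coheight_eq_length[OF p] show ?thesis by simp
qed

text \<open>Induction along the walk from the root: each arc raises the coheight by exactly one and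
  the color by at least one.\<close>

lemma coheight_less_increasing_coloring:
  assumes f: "f \<in> increasing_colorings T" and v: "v \<in> verts T"
  shows "coheight T r v < f v"
proof -
  from v obtain p where "awalk r p v" using unique_awalk by blast
  then show ?thesis
  proof (induction p arbitrary: v rule: rev_induct)
    \<comment> \<open>The empty walk forces \<open>v = r\<close>, of coheight 0; strictness comes
      from colors starting at 1.\<close>
    case Nil
    then have "f v \<ge> 1" using f by (auto simp: increasing_colorings_def awalk_simps PiE_iff)
    then show ?case using Nil by (simp add: coheight_eq_length)
  next
    case (snoc e p)
    then have p: "awalk r p (tail T e)" and e: "tail T e \<rightarrow>\<^bsub>T\<^esub> v"
      by (auto simp: awalk_simps intro: in_arcs_imp_in_arcs_ends)
    have "f (tail T e) < f v" using f e by (auto simp: increasing_colorings_def)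
    with snoc.IH[OF p] coheight_arc[OF e] show ?case by simp
  qed
qed

text \<open>The lower bound on colors is attained at all vertices at once. \<open>restrict\<close>
  is there because colorings are extensional functions on \<open>verts T\<close>.\<close>

lemma Suc_coheight_increasing:
  "restrict (\<lambda>v. Suc (coheight T r v)) (verts T) \<in> increasing_colorings T"
  using coheight_arc by (auto simp: increasing_colorings_def)

lemma sampling_function_0_0:
  "sampling_function T (0, 0) = Some (labelling_monomial T (\<lambda>v. Suc (coheight T r v)))"
proof -
  let ?g = "restrict (\<lambda>v. Suc (coheight T r v)) (verts T)"
  let ?m = "labelling_monomial T (\<lambda>v. Suc (coheight T r v))"
  have m: "labelling_monomial T ?g = ?m"
    by (simp add: labelling_monomial_def)
  \<comment> \<open>Finiteness matters here: \<open>card\<close> of an infinite set would be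
    0.\<close>
  have nz: "Gamma_less T m \<noteq> 0 \<longleftrightarrow> (\<exists>f \<in> increasing_colorings T. labelling_monomial T f = m)" for m
    using finite_colorings_of_monomial[of T m] by (auto simp: Gamma_less_def)
  have max: "m \<le> ?m" if "Gamma_less T m \<noteq> 0" for m
    using that coheight_less_increasing_coloring
    by (auto simp: nz Suc_le_eq intro!: labelling_monomial_antimono)
  have "Gamma_less T ?m \<noteq> 0"
    using m Suc_coheight_increasing unfolding nz by blast
  with max have "max_monomial (Gamma_less T) = Some ?m"
    by (auto simp: max_monomial_def intro: Greatest_equality)
  \<comment> \<open>The index range \<open>{1..0}\<close> is empty, so the bracket keeps the whole
    series; \<open>(0, 0)\<close> lies in the domain because the zero monomial has no keys.\<close>
  then show ?thesis by (simp add: sampling_function_def restrict_terms_def)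
qed

text \<open>Undoing the index shift shows that the profile depends on the tree only through one
  value of the sampling function.\<close>

lemma lookup_coheight_profile:
  "Poly_Mapping.lookup (coheight_profile T r) k =
     Poly_Mapping.lookup (the (sampling_function T (0, 0))) (Suc k)"
  by (simp add: coheight_profile_def sampling_function_0_0 lookup_labelling_monomial)

end

theorem theorem5p1:
  fixes T :: "('a, 'b) pre_digraph" and T' :: "('c, 'd) pre_digraph"
    and r :: 'a and r' :: 'c
  assumes "finite_rooted_tree T r" and "finite_rooted_tree T' r'"
    and "sampling_function T = sampling_function T'"
  shows "coheight_profile T r = coheight_profile T' r'"
  using assms by (intro poly_mapping_eqI) (simp add: finite_rooted_tree.lookup_coheight_profile)

end
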